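(* Define $\mathbf E_{ijk}=\sigma_e^2(1-m_{ij}/m_U)\,\mathbf I_{n(ijk)}$, where $\mathbf I_{n(ijk)}$ denotes the $n\times n$ diagonal matrix with a one at the diagonal position corresponding to the lexicographic index of $(i,j,k)$ and zeros elsewhere. For each $(a,b,c)$ with $a\in\{1,\dots,g\}$, $b\in\{1,\dots,h\}$, $c\in\{1,\dots,m_{ab}\}$, define $\mathcal L_{ab}=\{(i,j):\ i<a\text{ or }(i=a,\ j<b)\}$ and $$\mathbf W_{abc+1}=\check{\mathbf V}+\sum_{(i,j)\in\mathcal L_{ab}}\sum_{k=1}^{m_{ij}}\mathbf E_{ijk}+\sum_{k=1}^{c}\mathbf E_{abk},$$ with $\mathbf W_{111}=\check{\mathbf V}$, where the subscript $abc+1$ denotes the element following $(a,b,c)$ in the lexicographic order. Assume that each matrix $\mathbf W_{abc}$ is nonsingular. Then $\mathbf W_{111}^{-1}=\check{\mathbf V}^{-1}$ and $$\mathbf W_{abc+1}^{-1}=\mathbf W_{abc}^{-1}-\kappa_{abc}\,\mathbf W_{abc}^{-1}\mathbf E_{abc}\mathbf W_{abc}^{-1},\qquad \kappa_{abc}=\frac{1}{1+\operatorname{tr}(\mathbf W_{abc}^{-1}\mathbf E_{abc})}.$$ In particular, $$\mathbf V^{-1}=\mathbf W_{gh\,m_{gh}}^{-1}-\kappa_{gh\,m_{gh}}\,\mathbf W_{gh\,m_{gh}}^{-1}\mathbf E_{gh\,m_{gh}}\mathbf W_{gh\,m_{gh}}^{-1}.$$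
   Context: Setting. $g,h\ge 1$ are integers, $m_{ij}\ge 1$ ($1\le i\le g$, $1\le j\le h$) are integers (cell sizes), $n=\sum_{i,j}m_{ij}$, $m_U=\max_{i,j}m_{ij}$. The $n$ observations are indexed by triples $(i,j,k)$, $1\le i\le g$, $1\le j\le h$, $1\le k\le m_{ij}$, in lexicographic order. The variance components satisfy $\sigma_\alpha^2,\sigma_\beta^2,\sigma_\gamma^2\ge0$, $\sigma_e^2>0$. Matrices. $\mathbf D$ is the $n\times n$ matrix with entries $\mathbf D_{(i,j,k),(i',j',k')}=\sigma_\alpha^2\mathbb 1[i=i']+\sigma_\beta^2\mathbb 1[j=j']+\sigma_\gamma^2\mathbb 1[(i,j)=(i',j')]$. The covariance matrix is $\mathbf V=\sigma_e^2\mathbf I_n+\mathbf D$, and the modified covariance matrix is $\check{\mathbf V}=\frac{\sigma_e^2}{m_U}\mathbf I_{\mathbf m}^M+\mathbf D$ with $\mathbf I_{\mathbf m}^M=\operatorname{diag}(m_{11}\mathbf I_{m_{11}},\dots,m_{gh}\mathbf I_{m_{gh}})$. Convention: the element following the last triple $(g,h,m_{gh})$ is a formal final index; thus $\mathbf W_{abc}$ is $\check{\mathbf V}$ plus the sum of all $\mathbf E_{ijk}$ with $(i,j,k)$ strictly before $(a,b,c)$, and $\mathbf W_{gh\,m_{gh}+1}$ is $\check{\mathbf V}$ plus the sum of all $\mathbf E_{ijk}$. *)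

theory Defs
  imports Jordan_Normal_Form.Gauss_Jordan_Elimination
begin

definition mat_trace :: "real mat \<Rightarrow> real" where
  "mat_trace A = (\<Sum>p<dim_row A. A $$ (p, p))"

text \<open>The inverse of a nonsingular square matrix; the value is unspecified on singular
  matrices, so uses of it are to be accompanied by \<^const>\<open>invertible_mat\<close>.\<close>

definition mat_inv :: "real mat \<Rightarrow> real mat" where
  "mat_inv A = the (mat_inverse A)"

lemma mat_inv_inverts:
  assumes A: "A \<in> carrier_mat n n" and inv: "invertible_mat A"
  shows "mat_inv A \<in> carrier_mat n n" "A * mat_inv A = 1\<^sub>m n" "mat_inv A * A = 1\<^sub>m n"
proof -
  obtain B where B: "A * B = 1\<^sub>m (dim_row A)" "B * A = 1\<^sub>m (dim_row B)"
    using inv unfolding invertible_mat_def inverts_mat_def by auto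
  have "dim_col B = n" using A arg_cong[OF B(1), of dim_col] by simp
  moreover have "dim_row B = n" using A arg_cong[OF B(2), of dim_col] by simp
  ultimately have Bc: "B \<in> carrier_mat n n" by auto
  have "A \<in> Units (ring_mat TYPE(real) n undefined)"
    using A B Bc unfolding Units_def ring_mat_def by auto
  then obtain C where C: "mat_inverse A = Some C"
    using mat_inverse(1)[OF A, of undefined] by (cases "mat_inverse A") blast+
  show "mat_inv A \<in> carrier_mat n n" "A * mat_inv A = 1\<^sub>m n" "mat_inv A * A = 1\<^sub>m n"
    using mat_inverse(2)[OF A C] C by (auto simp: mat_inv_def)
qed

text \<open>Finite sums of \<open>n \<times> n\<close> matrices. The type of matrices of varying dimension is
  not an additive monoid, so the library's \<^const>\<open>sum\<close> is only available entrywise.\<close>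

definition msum :: "nat \<Rightarrow> ('i \<Rightarrow> real mat) \<Rightarrow> 'i set \<Rightarrow> real mat" where
  "msum n F S = mat n n (\<lambda>(p, q). \<Sum>s\<in>S. F s $$ (p, q))"

type_synonym obs = "nat \<times> nat \<times> nat"

text \<open>Only the values \<open>m i j\<close> with \<open>1 \<le> i \<le> g\<close>, \<open>1 \<le> j \<le> h\<close> are relevant.\<close>

definition triples :: "nat \<Rightarrow> nat \<Rightarrow> (nat \<Rightarrow> nat \<Rightarrow> nat) \<Rightarrow> obs set" where
  "triples g h m = {(i, j, k). i \<in> {1..g} \<and> j \<in> {1..h} \<and> k \<in> {1..m i j}}"

definition obs_list :: "nat \<Rightarrow> nat \<Rightarrow> (nat \<Rightarrow> nat \<Rightarrow> nat) \<Rightarrow> obs list" where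
  "obs_list g h m =
     [(i, j, k). i \<leftarrow> [1..<Suc g], j \<leftarrow> [1..<Suc h], k \<leftarrow> [1..<Suc (m i j)]]"

definition lex_before :: "(obs \<times> obs) set" where
  "lex_before = less_than <*lex*> less_than <*lex*> less_than"

definition n_obs :: "nat \<Rightarrow> nat \<Rightarrow> (nat \<Rightarrow> nat \<Rightarrow> nat) \<Rightarrow> nat" where
  "n_obs g h m = (\<Sum>i\<in>{1..g}. \<Sum>j\<in>{1..h}. m i j)"

definition m_U :: "nat \<Rightarrow> nat \<Rightarrow> (nat \<Rightarrow> nat \<Rightarrow> nat) \<Rightarrow> nat" where
  "m_U g h m = Max {m i j | i j. i \<in> {1..g} \<and> j \<in> {1..h}}"

lemma set_obs_list: "set (obs_list g h m) = triples g h m"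
  unfolding obs_list_def triples_def by (auto simp: image_iff)

lemma sorted_obs_list: "sorted_wrt (\<lambda>s t. (s, t) \<in> lex_before) (obs_list g h m)"
proof -
  have concat: "sorted_wrt R (concat (map f xs))"
    if "sorted_wrt (<) xs" "\<And>x. x \<in> set xs \<Longrightarrow> sorted_wrt R (f x)"
      "\<And>x y u v. x < y \<Longrightarrow> u \<in> set (f x) \<Longrightarrow> v \<in> set (f y) \<Longrightarrow> R u v"
    for R :: "obs \<Rightarrow> obs \<Rightarrow> bool" and f and xs :: "nat list"
    using that by (induction xs) (auto simp: sorted_wrt_append)
  show ?thesis unfolding obs_list_def
    by (intro concat) (auto simp: lex_before_def sorted_wrt_map simp del: upt_Suc)
qed

lemma length_obs_list: "length (obs_list g h m) = n_obs g h m"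
proof -
  have "length (concat (map f [1..<Suc k])) = (\<Sum>i\<in>{1..k}. length (f i))"
    for f :: "nat \<Rightarrow> obs list" and k
    by (induction k) auto
  then show ?thesis unfolding obs_list_def n_obs_def by (simp del: upt_Suc)
qed

text \<open>Matrix rows and columns are numbered from \<open>0\<close>; position \<open>p\<close> belongs to the
  triple \<open>obs_list g h m ! p\<close>. The arguments \<open>va\<close>, \<open>vb\<close>, \<open>vg\<close>, \<open>ve\<close> are the variance
  components \<open>\<sigma>\<^sub>\<alpha>\<^sup>2\<close>, \<open>\<sigma>\<^sub>\<beta>\<^sup>2\<close>, \<open>\<sigma>\<^sub>\<gamma>\<^sup>2\<close>, \<open>\<sigma>\<^sub>e\<^sup>2\<close> themselves (not standard deviations).\<close>

definition D_mat ::
    "nat \<Rightarrow> nat \<Rightarrow> (nat \<Rightarrow> nat \<Rightarrow> nat) \<Rightarrow> real \<Rightarrow> real \<Rightarrow> real \<Rightarrow> real mat" where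
  "D_mat g h m va vb vg = mat (n_obs g h m) (n_obs g h m) (\<lambda>(p, q).
     case (obs_list g h m ! p, obs_list g h m ! q) of ((i, j, k), (i', j', k')) \<Rightarrow>
       va * of_bool (i = i') + vb * of_bool (j = j') + vg * of_bool ((i, j) = (i', j')))"

definition V_mat ::
    "nat \<Rightarrow> nat \<Rightarrow> (nat \<Rightarrow> nat \<Rightarrow> nat) \<Rightarrow> real \<Rightarrow> real \<Rightarrow> real \<Rightarrow> real \<Rightarrow> real mat" where
  "V_mat g h m va vb vg ve = ve \<cdot>\<^sub>m 1\<^sub>m (n_obs g h m) + D_mat g h m va vb vg"

definition IM_mat :: "nat \<Rightarrow> nat \<Rightarrow> (nat \<Rightarrow> nat \<Rightarrow> nat) \<Rightarrow> real mat" where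
  "IM_mat g h m = mat (n_obs g h m) (n_obs g h m) (\<lambda>(p, q).
     if p = q then case obs_list g h m ! p of (i, j, k) \<Rightarrow> real (m i j) else 0)"

definition Vcheck_mat ::
    "nat \<Rightarrow> nat \<Rightarrow> (nat \<Rightarrow> nat \<Rightarrow> nat) \<Rightarrow> real \<Rightarrow> real \<Rightarrow> real \<Rightarrow> real \<Rightarrow> real mat" where
  "Vcheck_mat g h m va vb vg ve =
     (ve / real (m_U g h m)) \<cdot>\<^sub>m IM_mat g h m + D_mat g h m va vb vg"

definition unit_diag :: "nat \<Rightarrow> nat \<Rightarrow> (nat \<Rightarrow> nat \<Rightarrow> nat) \<Rightarrow> obs \<Rightarrow> real mat" where
  "unit_diag g h m t = mat (n_obs g h m) (n_obs g h m) (\<lambda>(p, q).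
     if p = q \<and> obs_list g h m ! p = t then 1 else 0)"

fun E_mat :: "nat \<Rightarrow> nat \<Rightarrow> (nat \<Rightarrow> nat \<Rightarrow> nat) \<Rightarrow> real \<Rightarrow> obs \<Rightarrow> real mat" where
  "E_mat g h m ve (i, j, k) =
     (ve * (1 - real (m i j) / real (m_U g h m))) \<cdot>\<^sub>m unit_diag g h m (i, j, k)"

definition cells_before :: "nat \<Rightarrow> nat \<Rightarrow> nat \<Rightarrow> nat \<Rightarrow> (nat \<times> nat) set" where
  "cells_before g h a b =
     {(i, j). i \<in> {1..g} \<and> j \<in> {1..h} \<and> (i < a \<or> (i = a \<and> j < b))}"

text \<open>The lexicographic successor. The successor of the last triple \<open>(g, h, m g h)\<close> is the
  formal final index \<open>(g, h, m g h + 1)\<close>, which comes after every triple.\<close>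

fun next_triple :: "nat \<Rightarrow> nat \<Rightarrow> (nat \<Rightarrow> nat \<Rightarrow> nat) \<Rightarrow> obs \<Rightarrow> obs" where
  "next_triple g h m (a, b, c) =
     (if c < m a b then (a, b, c + 1)
      else if b < h then (a, b + 1, 1)
      else if a < g then (a + 1, 1, 1)
      else (a, b, c + 1))"

definition W_mat ::
    "nat \<Rightarrow> nat \<Rightarrow> (nat \<Rightarrow> nat \<Rightarrow> nat) \<Rightarrow> real \<Rightarrow> real \<Rightarrow> real \<Rightarrow> real \<Rightarrow> obs \<Rightarrow> real mat" where
  "W_mat g h m va vb vg ve t = Vcheck_mat g h m va vb vg ve
     + msum (n_obs g h m) (E_mat g h m ve) {s \<in> triples g h m. (s, t) \<in> lex_before}"

definition kappa ::
    "nat \<Rightarrow> nat \<Rightarrow> (nat \<Rightarrow> nat \<Rightarrow> nat) \<Rightarrow> real \<Rightarrow> real \<Rightarrow> real \<Rightarrow> real \<Rightarrow> obs \<Rightarrow> real" where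
  "kappa g h m va vb vg ve t =
     1 / (1 + mat_trace (mat_inv (W_mat g h m va vb vg ve t) * E_mat g h m ve t))"

lemma finite_triples: "finite (triples g h m)"
  by (metis List.finite_set set_obs_list)

lemma next_triple_lex:
  assumes t: "t \<in> triples g h m" and s: "s \<in> triples g h m"
  shows "(s, next_triple g h m t) \<in> lex_before \<longleftrightarrow> (s, t) \<in> lex_before \<or> s = t"
proof -
  obtain a b c where t': "t = (a, b, c)" by (cases t)
  obtain i j k where s': "s = (i, j, k)" by (cases s)
  have "i \<le> g" "j \<le> h" "1 \<le> i" "1 \<le> j" "1 \<le> k" "k \<le> m i j" "a \<le> g" "b \<le> h" "1 \<le> c" "c \<le> m a b"
    using s t by (auto simp: s' t' triples_def)
  then show ?thesis
    unfolding s' t' lex_before_def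
    by (cases "i = a"; cases "j = b") (auto simp: not_less)
qed

text \<open>The partial sums at the initial index and at a successor, written out.\<close>

lemma W_mat_first: "W_mat g h m va vb vg ve (1, 1, 1) = Vcheck_mat g h m va vb vg ve"
proof -
  have "{s \<in> triples g h m. (s, (1, 1, 1)) \<in> lex_before} = {}"
    by (auto simp: triples_def lex_before_def)
  then show ?thesis
    unfolding W_mat_def by (simp only:) (auto intro!: eq_matI simp: msum_def Vcheck_mat_def D_mat_def IM_mat_def)
qed

lemma W_mat_next:
  assumes t: "(a, b, c) \<in> triples g h m"
  defines "n \<equiv> n_obs g h m"
  shows "W_mat g h m va vb vg ve (next_triple g h m (a, b, c)) =
    Vcheck_mat g h m va vb vg ve
    + msum n (\<lambda>(i, j). msum n (\<lambda>k. E_mat g h m ve (i, j, k)) {1..m i j}) (cells_before g h a b)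
    + msum n (\<lambda>k. E_mat g h m ve (a, b, k)) {1..c}"
proof -
  let ?E = "E_mat g h m ve"
  let ?C = "Sigma (cells_before g h a b) (\<lambda>(i, j). {1..m i j})"
  let ?f = "\<lambda>((i, j), k). (i, j, k) :: obs"
  let ?T = "?f ` ?C \<union> (\<lambda>k. (a, b, k)) ` {1..c}"
  have fin: "finite (cells_before g h a b)"
    by (rule finite_subset[of _ "{1..g} \<times> {1..h}"]) (auto simp: cells_before_def)
  then have finC: "finite ?C" by auto
  have ab: "a \<in> {1..g}" "b \<in> {1..h}" "c \<in> {1..m a b}" using t by (auto simp: triples_def)
  have "{s \<in> triples g h m. (s, next_triple g h m (a, b, c)) \<in> lex_before}
      = {s \<in> triples g h m. (s, (a, b, c)) \<in> lex_before \<or> s = (a, b, c)}"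
    using next_triple_lex[OF t] by blast
  also have "\<dots> = ?f ` ?C \<union> (\<lambda>k. (a, b, k)) ` {1..c}" (is "?S = _")
  proof (rule Set.set_eqI)
    fix s :: obs
    obtain i j k where s: "s = (i, j, k)" by (cases s)
    have "s \<in> ?f ` ?C \<longleftrightarrow> (i, j) \<in> cells_before g h a b \<and> k \<in> {1..m i j}"
      unfolding s by (force simp: image_iff)
    then show "s \<in> ?S \<longleftrightarrow> s \<in> ?T"
      using ab unfolding s by (auto simp: triples_def lex_before_def cells_before_def)
  qed
  finally have S: "{s \<in> triples g h m. (s, next_triple g h m (a, b, c)) \<in> lex_before} = ?T" .
  have disj: "?f ` ?C \<inter> (\<lambda>k. (a, b, k)) ` {1..c} = {}"
    by (auto simp: cells_before_def)
  have sums: "(\<Sum>s\<in>?T. ?E s $$ (p, q)) =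
      (\<Sum>(i, j)\<in>cells_before g h a b. \<Sum>k\<in>{1..m i j}. ?E (i, j, k) $$ (p, q))
      + (\<Sum>k\<in>{1..c}. ?E (a, b, k) $$ (p, q))" for p q
  proof -
    have "(\<Sum>s\<in>?T. ?E s $$ (p, q)) = (\<Sum>s\<in>?f ` ?C. ?E s $$ (p, q))
        + (\<Sum>s\<in>(\<lambda>k. (a, b, k)) ` {1..c}. ?E s $$ (p, q))"
      using finC disj by (intro sum.union_disjoint) auto
    also have "(\<Sum>s\<in>?f ` ?C. ?E s $$ (p, q)) = (\<Sum>x\<in>?C. ?E (?f x) $$ (p, q))"
      by (subst sum.reindex) (auto simp: inj_on_def)
    also have "\<dots> = (\<Sum>x\<in>cells_before g h a b.
        \<Sum>k\<in>(case x of (i, j) \<Rightarrow> {1..m i j}). ?E (?f (x, k)) $$ (p, q))"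
      using fin by (subst sum.Sigma) (auto simp: split_def)
    also have "\<dots> = (\<Sum>(i, j)\<in>cells_before g h a b. \<Sum>k\<in>{1..m i j}. ?E (i, j, k) $$ (p, q))"
      by (intro sum.cong) auto
    also have "(\<Sum>s\<in>(\<lambda>k. (a, b, k)) ` {1..c}. ?E s $$ (p, q))
        = (\<Sum>k\<in>{1..c}. ?E (a, b, k) $$ (p, q))"
      by (subst sum.reindex) (auto simp: inj_on_def)
    finally show ?thesis .
  qed
  have inner: "(\<Sum>x\<in>cells_before g h a b.
        (case x of (i, j) \<Rightarrow> msum n (\<lambda>k. ?E (i, j, k)) {1..m i j}) $$ (p, q))
      = (\<Sum>(i, j)\<in>cells_before g h a b. \<Sum>k\<in>{1..m i j}. ?E (i, j, k) $$ (p, q))"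
    if "p < n" "q < n" for p q
    using that by (intro sum.cong) (auto simp: msum_def)
  have dims: "dim_row (D_mat g h m va vb vg) = n" "dim_col (D_mat g h m va vb vg) = n"
    "\<And>F S. dim_row (msum n F S) = n" "\<And>F S. dim_col (msum n F S) = n"
    by (auto simp: D_mat_def msum_def n_def)
  have msum_cell: "msum n F S $$ (p, q) = (\<Sum>s\<in>S. F s $$ (p, q))"
    if "p < n" "q < n" for F :: "nat \<times> nat \<Rightarrow> real mat" and S p q
    using that by (simp add: msum_def)
  have msum_obs: "msum n F S $$ (p, q) = (\<Sum>s\<in>S. F s $$ (p, q))"
    if "p < n" "q < n" for F :: "obs \<Rightarrow> real mat" and S p q
    using that by (simp add: msum_def)
  have msum_num: "msum n F S $$ (p, q) = (\<Sum>s\<in>S. F s $$ (p, q))"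
    if "p < n" "q < n" for F :: "nat \<Rightarrow> real mat" and S p q
    using that by (simp add: msum_def)
  show ?thesis
    unfolding W_mat_def S n_def[symmetric]
    by (rule eq_matI)
      (simp_all add: dims msum_cell msum_obs msum_num sums inner Vcheck_mat_def
        del: E_mat.simps One_nat_def)
qed

end

theory Submission
  imports Defs "Jordan_Normal_Form.Determinant"
begin

text \<open>The update step is the Sherman--Morrison formula. Writing \<open>A\<close> for the inverse of \<open>W\<close>, the
  rank one property of the update \<open>E\<close> enters only through \<open>E A E = tr (A E) E\<close>. This identity gives
  \<open>(W + E) A E = (1 + tr (A E)) E\<close>, so \<open>1 + tr (A E) \<noteq> 0\<close> as soon as \<open>W + E\<close> is nonsingular.
  Every successor is nonsingular by hypothesis, except the one at the formal final index. That
  one is \<open>V\<close>, which is nonsingular because \<open>D\<close> is positive semidefinite: an indicator kernel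
  \<open>[f p = f q]\<close> has a quadratic form that is a sum of squares over the classes of \<open>f\<close>.\<close>

section \<open>Rank one update of an inverse\<close>

lemma mat_inv_eqI:
  assumes A: "A \<in> carrier_mat n n" and B: "B \<in> carrier_mat n n"
    and inv: "invertible_mat A" and AB: "A * B = 1\<^sub>m n"
  shows "mat_inv A = B"
proof -
  note I = mat_inv_inverts[OF A inv]
  have "mat_inv A = mat_inv A * (A * B)" using I(1) AB by simp
  also have "\<dots> = mat_inv A * A * B" using I(1) A B by simp
  also have "\<dots> = B" using I(3) B by simp
  finally show ?thesis .
qed

text \<open>The rank one property is assumed as an identity for \<open>E * A * E\<close> instead of
  a factorization E = u v^T, so the whole argument stays within square matrices. The claimed inverse
  is checked as a right inverse, which suffices by \<open>mat_inv_eqI\<close>.\<close>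

lemma mat_inv_rank_one_update:
  assumes W: "W \<in> carrier_mat n n" and E: "E \<in> carrier_mat n n"
    and invW: "invertible_mat W" and invWE: "invertible_mat (W + E)"
  defines "A \<equiv> mat_inv W"
  assumes EAE: "E * A * E = mat_trace (A * E) \<cdot>\<^sub>m E"
  shows "mat_inv (W + E) = A - (1 / (1 + mat_trace (A * E))) \<cdot>\<^sub>m (A * E * A)"
proof -
  define t where "t = mat_trace (A * E)"
  note I = mat_inv_inverts[OF W invW, folded A_def]
  note A = I(1)
  have WE: "W + E \<in> carrier_mat n n" using W E by simp
  have AE: "A * E \<in> carrier_mat n n" and EA: "E * A \<in> carrier_mat n n"
    and AEA: "A * E * A \<in> carrier_mat n n" using A E by auto
  have WAE: "(W + E) * (A * E) = (1 + t) \<cdot>\<^sub>m E"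
  proof -
    have "(W + E) * (A * E) = W * (A * E) + E * (A * E)"
      using W E AE by (rule add_mult_distrib_mat)
    also have "W * (A * E) = E" using W A E I(2) by (simp flip: assoc_mult_mat)
    also have "E * (A * E) = t \<cdot>\<^sub>m E" using E A EAE by (simp add: t_def flip: assoc_mult_mat)
    finally show ?thesis using E by (auto simp: algebra_simps)
  qed
  \<comment> \<open>If 1 + t were 0, \<open>WAE\<close> would say (W + E)(A E) = 0. Cancelling the
    nonsingular W + E leaves A E = 0, whose trace t is 0, a contradiction.\<close>
  have nz: "1 + t \<noteq> 0"
  proof
    assume z: "1 + t = 0"
    note J = mat_inv_inverts[OF WE invWE]
    have "A * E = mat_inv (W + E) * (W + E) * (A * E)" unfolding J(3) by (rule left_mult_one_mat[OF AE, symmetric])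
    also have "\<dots> = mat_inv (W + E) * ((W + E) * (A * E))"
      using J(1) WE AE by (rule assoc_mult_mat)
    also have "\<dots> = 0\<^sub>m n n" using z J(1) E unfolding WAE by (auto intro!: eq_matI)
    finally have "t = 0" by (simp add: t_def mat_trace_def)
    with z show False by simp
  qed
  \<comment> \<open>The first product expands to I + E A. By \<open>WAE\<close> the second is (1 +
    t) E A, where the scalar cancels, so the difference is I.\<close>
  have "(W + E) * (A - (1 / (1 + t)) \<cdot>\<^sub>m (A * E * A))
      = (W + E) * A - (W + E) * ((1 / (1 + t)) \<cdot>\<^sub>m (A * E * A))"
    using WE A AEA by (intro mult_minus_distrib_mat) auto
  also have "(W + E) * A = 1\<^sub>m n + E * A"
    using W E A I(2) by (simp add: add_mult_distrib_mat)
  also have "(W + E) * ((1 / (1 + t)) \<cdot>\<^sub>m (A * E * A)) = (1 / (1 + t)) \<cdot>\<^sub>m ((W + E) * (A * E * A))"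
    using WE AEA by (rule mult_smult_distrib)
  also have "(W + E) * (A * E * A) = (1 + t) \<cdot>\<^sub>m (E * A)"
    unfolding assoc_mult_mat[OF WE AE A, symmetric] WAE by (rule mult_smult_assoc_mat[OF E A])
  also have "(1 / (1 + t)) \<cdot>\<^sub>m ((1 + t) \<cdot>\<^sub>m (E * A)) = E * A"
    using nz by (auto intro!: eq_matI)
  also have "1\<^sub>m n + E * A - E * A = 1\<^sub>m n"
    using EA carrier_matD[OF EA] by (intro eq_matI) (simp_all del: index_mult_mat)
  finally have "(W + E) * (A - (1 / (1 + t)) \<cdot>\<^sub>m (A * E * A)) = 1\<^sub>m n" .
  moreover have "A - (1 / (1 + t)) \<cdot>\<^sub>m (A * E * A) \<in> carrier_mat n n"
    using AEA by (intro minus_carrier_mat smult_carrier_mat)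
  ultimately show ?thesis
    using mat_inv_eqI[OF WE _ invWE] unfolding t_def by blast
qed

text \<open>Both sides vanish outside position (p, p), where each equals e * A_pp * e, because tr(A
  E) = e * A_pp. The value e = 0 is allowed; it occurs for cells of maximal size.\<close>

lemma single_entry_sandwich:
  assumes A: "A \<in> carrier_mat n n" and p: "p < n"
    and E: "E = mat n n (\<lambda>(r, s). if r = p \<and> s = p then e else 0)"
  shows "E * A * E = mat_trace (A * E) \<cdot>\<^sub>m E"
proof -
  have E': "E \<in> carrier_mat n n" by (simp add: E)
  have EA: "(E * A) $$ (r, s) = (if r = p then e * A $$ (p, s) else 0)" if "r < n" "s < n" for r s
    using that A p by (auto simp: E scalar_prod_def if_distrib[of "\<lambda>x. x * _"] cong: if_cong)
  have AE: "(A * E) $$ (r, s) = (if s = p then e * A $$ (r, p) else 0)" if "r < n" "s < n" for r s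
    using that A p by (auto simp: E scalar_prod_def if_distrib[of "\<lambda>x. _ * x"] cong: if_cong)
  have "mat_trace (A * E) = (\<Sum>r<n. if r = p then e * A $$ (r, p) else 0)"
    unfolding mat_trace_def using A AE by (intro sum.cong) auto
  then have tr: "mat_trace (A * E) = e * A $$ (p, p)" using p by simp
  have "(E * A * E) $$ (r, s) = (mat_trace (A * E) \<cdot>\<^sub>m E) $$ (r, s)" if "r < n" "s < n" for r s
  proof -
    have "(E * A * E) $$ (r, s) = (\<Sum>k<n. (E * A) $$ (r, k) * E $$ (k, s))"
      using that A E' by (subst index_mult_mat) (auto simp: scalar_prod_def atLeast0LessThan
          simp del: assoc_mult_mat)
    also have "\<dots> = (\<Sum>k<n. if k = p then (E * A) $$ (r, p) * E $$ (p, s) else 0)"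
      using that p by (intro sum.cong) (auto simp: E)
    also have "\<dots> = (E * A) $$ (r, p) * E $$ (p, s)" using p by simp
    finally show ?thesis using that p EA unfolding tr by (auto simp: E)
  qed
  then show ?thesis using A E' by (intro eq_matI) auto
qed

section \<open>Nonsingularity of the covariance matrix V\<close>

lemma invertible_mat_if_trivial_kernel:
  fixes A :: "real mat"
  assumes A: "A \<in> carrier_mat n n"
    and ker: "\<And>v. v \<in> carrier_vec n \<Longrightarrow> A *\<^sub>v v = 0\<^sub>v n \<Longrightarrow> v = 0\<^sub>v n"
  shows "invertible_mat A"
proof -
  have "det A \<noteq> 0" using det_0_iff_vec_prod_zero_field[OF A] ker by blast
  then have "A \<in> Units (ring_mat TYPE(real) n undefined)"
    by (rule det_non_zero_imp_unit[OF A])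
  then show ?thesis
    using A unfolding Units_def ring_mat_def invertible_mat_def inverts_mat_def by auto
qed

text \<open>The kernel splits as [f p = f q] = sum over c of [f p = c] [f q = c]. After exchanging
  sums, each class c contributes the square of the sum of x over that class.\<close>

lemma sum_eq_kernel_nonneg:
  fixes x :: "'a \<Rightarrow> real"
  assumes "finite S"
  shows "0 \<le> (\<Sum>p\<in>S. \<Sum>q\<in>S. x p * of_bool (f p = f q) * x q)"
proof -
  have "(\<Sum>p\<in>S. \<Sum>q\<in>S. x p * of_bool (f p = f q) * x q)
      = (\<Sum>p\<in>S. \<Sum>q\<in>S. \<Sum>c\<in>f ` S. (x p * of_bool (f p = c)) * (x q * of_bool (f q = c)))"
  proof (intro sum.cong refl)
    fix p q assume "p \<in> S" "q \<in> S"
    have "(\<Sum>c\<in>f ` S. (x p * of_bool (f p = c)) * (x q * of_bool (f q = c)))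
        = (\<Sum>c\<in>f ` S. if c = f p then x p * of_bool (f p = f q) * x q else 0)"
      by (intro sum.cong) auto
    then show "x p * of_bool (f p = f q) * x q
        = (\<Sum>c\<in>f ` S. (x p * of_bool (f p = c)) * (x q * of_bool (f q = c)))"
      using \<open>p \<in> S\<close> assms by simp
  qed
  also have "\<dots> = (\<Sum>p\<in>S. \<Sum>c\<in>f ` S. \<Sum>q\<in>S. (x p * of_bool (f p = c)) * (x q * of_bool (f q = c)))"
    by (intro sum.cong refl sum.swap)
  also have "\<dots> = (\<Sum>c\<in>f ` S. \<Sum>p\<in>S. \<Sum>q\<in>S. (x p * of_bool (f p = c)) * (x q * of_bool (f q = c)))"
    by (rule sum.swap)
  also have "\<dots> = (\<Sum>c\<in>f ` S. (\<Sum>p\<in>S. x p * of_bool (f p = c))\<^sup>2)"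
    by (simp only: power2_eq_square sum_product)
  also have "0 \<le> \<dots>" by (intro sum_nonneg) auto
  finally show ?thesis .
qed

lemma D_mat_carrier: "D_mat g h m va vb vg \<in> carrier_mat (n_obs g h m) (n_obs g h m)"
  by (simp add: D_mat_def)

lemma D_mat_psd:
  assumes "va \<ge> 0" "vb \<ge> 0" "vg \<ge> 0" and v: "v \<in> carrier_vec (n_obs g h m)"
  shows "0 \<le> v \<bullet> (D_mat g h m va vb vg *\<^sub>v v)"
proof -
  let ?n = "n_obs g h m" and ?o = "\<lambda>p. obs_list g h m ! p"
  let ?Q = "\<lambda>f :: nat \<Rightarrow> nat \<times> nat. \<Sum>p<?n. \<Sum>q<?n. v $ p * of_bool (f p = f q) * v $ q"
  \<comment> \<open>The classes are rows, columns and cells. Padding the first two with a constant 0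
    gives all three labels the type of pairs, so that the single abbreviation \<open>?Q\<close>
    serves for each.\<close>
  let ?a = "\<lambda>p. (fst (?o p), 0 :: nat)" and ?b = "\<lambda>p. (0 :: nat, fst (snd (?o p)))"
    and ?c = "\<lambda>p. (fst (?o p), fst (snd (?o p)))"
  have "v \<bullet> (D_mat g h m va vb vg *\<^sub>v v)
      = (\<Sum>p<?n. \<Sum>q<?n. v $ p * D_mat g h m va vb vg $$ (p, q) * v $ q)"
    using v by (auto simp: scalar_prod_def D_mat_def atLeast0LessThan sum_distrib_left mult.assoc
        intro!: sum.cong)
  also have "\<dots> = (\<Sum>p<?n. \<Sum>q<?n. va * (v $ p * of_bool (?a p = ?a q) * v $ q)
      + vb * (v $ p * of_bool (?b p = ?b q) * v $ q)
      + vg * (v $ p * of_bool (?c p = ?c q) * v $ q))"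
    by (intro sum.cong refl) (auto simp: D_mat_def split_def algebra_simps)
  also have "\<dots> = va * ?Q ?a + vb * ?Q ?b + vg * ?Q ?c"
    by (simp only: sum.distrib sum_distrib_left)
  also have "0 \<le> \<dots>"
    using assms by (intro add_nonneg_nonneg mult_nonneg_nonneg sum_eq_kernel_nonneg) auto
  finally show ?thesis .
qed

text \<open>If V v = 0, then 0 = v . V v = ve |v|^2 + v . D v. The last term is nonnegative and ve >
  0, so |v|^2 = 0.\<close>

lemma invertible_V_mat:
  assumes "va \<ge> 0" "vb \<ge> 0" "vg \<ge> 0" "ve > 0"
  shows "invertible_mat (V_mat g h m va vb vg ve)"
proof (rule invertible_mat_if_trivial_kernel[of _ "n_obs g h m"])
  let ?n = "n_obs g h m" and ?D = "D_mat g h m va vb vg"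
  show "V_mat g h m va vb vg ve \<in> carrier_mat ?n ?n"
    using D_mat_carrier by (simp add: V_mat_def)
  fix v assume v: "v \<in> carrier_vec ?n" and "V_mat g h m va vb vg ve *\<^sub>v v = 0\<^sub>v ?n"
  have Dv: "?D *\<^sub>v v \<in> carrier_vec ?n" using D_mat_carrier v by (rule mult_mat_vec_carrier)
  have "V_mat g h m va vb vg ve *\<^sub>v v = (ve \<cdot>\<^sub>m 1\<^sub>m ?n) *\<^sub>v v + ?D *\<^sub>v v"
    unfolding V_mat_def using D_mat_carrier v by (intro add_mult_distrib_mat_vec) auto
  also have "(ve \<cdot>\<^sub>m 1\<^sub>m ?n) *\<^sub>v v = ve \<cdot>\<^sub>v v"
    using v by (auto simp: smult_scalar_prod_distrib intro!: eq_vecI)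
  finally have "v \<bullet> (ve \<cdot>\<^sub>v v + ?D *\<^sub>v v) = 0"
    using v \<open>_ = 0\<^sub>v ?n\<close> by (metis scalar_prod_right_zero)
  then have "ve * (v \<bullet> v) + v \<bullet> (?D *\<^sub>v v) = 0"
    using v Dv by (simp add: scalar_prod_add_distrib)
  moreover have "0 \<le> v \<bullet> (?D *\<^sub>v v)" using assms v by (intro D_mat_psd)
  ultimately have "ve * (v \<bullet> v) \<le> 0" by linarith
  then have "v \<bullet> v \<le> 0" using \<open>ve > 0\<close> by (simp add: mult_le_0_iff)
  then have "(\<Sum>p<?n. (v $ p)\<^sup>2) \<le> 0"
    using v by (simp add: scalar_prod_def power2_eq_square atLeast0LessThan)
  then have "\<forall>p<?n. (v $ p)\<^sup>2 = 0"
    by (metis (no_types, lifting) finite_lessThan lessThan_iff order_antisym sum_nonneg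
        sum_nonneg_eq_0_iff zero_le_power2)
  then show "v = 0\<^sub>v ?n" using v by (intro eq_vecI) auto
qed

section \<open>The matrices E and the partial sums W\<close>

lemma E_mat_single_entry:
  assumes t: "t \<in> triples g h m"
  obtains p e where "p < n_obs g h m"
    "E_mat g h m ve t = mat (n_obs g h m) (n_obs g h m) (\<lambda>(r, s). if r = p \<and> s = p then e else 0)"
proof -
  \<comment> \<open>The order is irreflexive, so a list sorted by it has no repetition. Hence each
    triple occupies exactly one position, and \<open>unit_diag\<close> has a single nonzero
    entry.\<close>
  have "distinct ts" if "sorted_wrt (\<lambda>s t. (s, t) \<in> lex_before) ts" for ts
    using that by (induction ts) (auto simp: lex_before_def)
  then have dist: "distinct (obs_list g h m)" using sorted_obs_list by blast
  obtain p where p: "p < n_obs g h m" "obs_list g h m ! p = t"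
    using t by (metis in_set_conv_nth length_obs_list set_obs_list)
  then have "obs_list g h m ! r = t \<longleftrightarrow> r = p" if "r < n_obs g h m" for r
    using that dist by (metis length_obs_list nth_eq_iff_index_eq)
  moreover obtain a b c where "t = (a, b, c)" by (cases t)
  ultimately show thesis
    by (intro that[OF p(1), of "ve * (1 - real (m a b) / real (m_U g h m))"] eq_matI)
      (auto simp: unit_diag_def)
qed

lemma W_mat_carrier:
  "W_mat g h m va vb vg ve t \<in> carrier_mat (n_obs g h m) (n_obs g h m)"
  by (simp add: W_mat_def msum_def)

lemma E_mat_carrier: "E_mat g h m ve t \<in> carrier_mat (n_obs g h m) (n_obs g h m)"
  by (cases t) (simp add: unit_diag_def)

text \<open>The triples before the successor of t are those before t together with t itself, so
  passing to the successor adds one summand. This includes the last triple, whose successor is the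
  formal final index.\<close>

lemma W_mat_step:
  assumes t: "t \<in> triples g h m"
  shows "W_mat g h m va vb vg ve (next_triple g h m t) = W_mat g h m va vb vg ve t + E_mat g h m ve t"
proof -
  let ?S = "{s \<in> triples g h m. (s, t) \<in> lex_before}"
  have "{s \<in> triples g h m. (s, next_triple g h m t) \<in> lex_before} = insert t ?S"
    using next_triple_lex[OF t] t by blast
  moreover have "t \<notin> ?S" "finite ?S"
    using finite_triples by (cases t; auto simp: lex_before_def)+
  ultimately show ?thesis
    using E_mat_carrier[of g h m ve t]
    by (intro eq_matI) (auto simp: W_mat_def msum_def Vcheck_mat_def D_mat_def IM_mat_def)
qed

lemma sum_E_mat_diag:
  assumes p: "p < n_obs g h m" and q: "q < n_obs g h m" and o: "obs_list g h m ! p = (a, b, c)"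
  shows "(\<Sum>s\<in>triples g h m. E_mat g h m ve s $$ (p, q))
    = (if p = q then ve * (1 - real (m a b) / real (m_U g h m)) else 0)"
proof -
  have "(a, b, c) \<in> triples g h m"
    using p o by (metis length_obs_list nth_mem set_obs_list)
  moreover have "(\<Sum>s\<in>triples g h m. E_mat g h m ve s $$ (p, q))
      = (\<Sum>s\<in>triples g h m. if s = (a, b, c)
          then (if p = q then ve * (1 - real (m a b) / real (m_U g h m)) else 0) else 0)"
    using p q o by (intro sum.cong) (auto simp: unit_diag_def split: if_splits)
  ultimately show ?thesis using finite_triples by simp
qed

text \<open>On the diagonal the full sum of the E restores the error variance: ve * m_ab / m_U + ve
  * (1 - m_ab / m_U) = ve. Off the diagonal only D remains.\<close>

lemma W_mat_final:
  assumes "g \<ge> 1" "h \<ge> 1"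
  shows "W_mat g h m va vb vg ve (g, h, m g h + 1) = V_mat g h m va vb vg ve"
proof -
  have S: "{s \<in> triples g h m. (s, (g, h, m g h + 1)) \<in> lex_before} = triples g h m"
    by (force simp: triples_def lex_before_def)
  show ?thesis
  proof (rule eq_matI)
    fix p q assume "p < dim_row (V_mat g h m va vb vg ve)" "q < dim_col (V_mat g h m va vb vg ve)"
    then have pq: "p < n_obs g h m" "q < n_obs g h m" by (auto simp: V_mat_def D_mat_def)
    obtain a b c where o: "obs_list g h m ! p = (a, b, c)" by (metis prod_cases3)
    show "W_mat g h m va vb vg ve (g, h, m g h + 1) $$ (p, q) = V_mat g h m va vb vg ve $$ (p, q)"
      using pq o D_mat_carrier[of g h m va vb vg] unfolding W_mat_def S
      by (auto simp: msum_def Vcheck_mat_def V_mat_def IM_mat_def sum_E_mat_diag[OF pq o]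
          algebra_simps)
  qed (auto simp: W_mat_def V_mat_def msum_def D_mat_def)
qed

text \<open>A successor that enters a new cell starts at its observation 1, which exists because
  cell sizes are at least 1.\<close>

lemma next_triple_cases:
  assumes "\<forall>i\<in>{1..g}. \<forall>j\<in>{1..h}. m i j \<ge> 1" and "t \<in> triples g h m"
  shows "next_triple g h m t \<in> triples g h m \<or> next_triple g h m t = (g, h, m g h + 1)"
  using assms by (cases t) (auto simp: triples_def)

theorem theorem5:
  fixes g h :: nat and m :: "nat \<Rightarrow> nat \<Rightarrow> nat" and va vb vg ve :: real
  assumes "g \<ge> 1" and "h \<ge> 1"
    and "\<forall>i\<in>{1..g}. \<forall>j\<in>{1..h}. m i j \<ge> 1"
    and "va \<ge> 0" and "vb \<ge> 0" and "vg \<ge> 0" and "ve > 0"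
    and "\<forall>t\<in>triples g h m. invertible_mat (W_mat g h m va vb vg ve t)"
  shows "mat_inv (W_mat g h m va vb vg ve (1, 1, 1)) = mat_inv (Vcheck_mat g h m va vb vg ve)
    \<and> (\<forall>t\<in>triples g h m.
         invertible_mat (W_mat g h m va vb vg ve (next_triple g h m t))
       \<and> mat_inv (W_mat g h m va vb vg ve (next_triple g h m t)) =
           mat_inv (W_mat g h m va vb vg ve t)
           - kappa g h m va vb vg ve t \<cdot>\<^sub>m
             (mat_inv (W_mat g h m va vb vg ve t) * E_mat g h m ve t
               * mat_inv (W_mat g h m va vb vg ve t)))
    \<and> invertible_mat (V_mat g h m va vb vg ve)
    \<and> mat_inv (V_mat g h m va vb vg ve) =
        mat_inv (W_mat g h m va vb vg ve (g, h, m g h))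
        - kappa g h m va vb vg ve (g, h, m g h) \<cdot>\<^sub>m
          (mat_inv (W_mat g h m va vb vg ve (g, h, m g h)) * E_mat g h m ve (g, h, m g h)
            * mat_inv (W_mat g h m va vb vg ve (g, h, m g h)))"
proof -
  let ?W = "W_mat g h m va vb vg ve" and ?E = "E_mat g h m ve"
  have V: "invertible_mat (V_mat g h m va vb vg ve)"
    using assms(4-7) by (rule invertible_V_mat)
  \<comment> \<open>A successor inside the index set is covered by the hypothesis; at the formal
    final index W is V.\<close>
  have inv: "invertible_mat (?W (next_triple g h m t))" if "t \<in> triples g h m" for t
    using next_triple_cases[OF assms(3) that] V W_mat_final[OF assms(1,2)] assms(8) by metis
  have step: "mat_inv (?W (next_triple g h m t)) = mat_inv (?W t)
      - kappa g h m va vb vg ve t \<cdot>\<^sub>m (mat_inv (?W t) * ?E t * mat_inv (?W t))"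
    if t: "t \<in> triples g h m" for t
  proof -
    have invt: "invertible_mat (?W t)" using assms(8) t by blast
    have "?E t * mat_inv (?W t) * ?E t = mat_trace (mat_inv (?W t) * ?E t) \<cdot>\<^sub>m ?E t"
      by (rule E_mat_single_entry[OF t])
        (rule single_entry_sandwich[OF mat_inv_inverts(1)[OF W_mat_carrier invt]])
    then show ?thesis
      using inv[OF t] invt unfolding W_mat_step[OF t] kappa_def
      by (intro mat_inv_rank_one_update[OF W_mat_carrier E_mat_carrier])
  qed
  have last: "(g, h, m g h) \<in> triples g h m"
    using assms(1-3) by (auto simp: triples_def)
  \<comment> \<open>The formula for V is the update step at the last triple, whose successor carries
    W = V.\<close>
  have "next_triple g h m (g, h, m g h) = (g, h, m g h + 1)" by simp
  then have "mat_inv (V_mat g h m va vb vg ve) = mat_inv (?W (g, h, m g h))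
      - kappa g h m va vb vg ve (g, h, m g h)
        \<cdot>\<^sub>m (mat_inv (?W (g, h, m g h)) * ?E (g, h, m g h) * mat_inv (?W (g, h, m g h)))"
    using step[OF last] W_mat_final[OF assms(1,2)] by metis
  then show ?thesis using W_mat_first V inv step by metis
qed

end
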